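(* Let $K$ be a finite field, let $m,n\ge 1$, let $\mathcal{T}\subset\mathcal{B}(m,n)$ be a subspace of dimension $\ell$ with bilinear rank $R=\operatorname{rk}(\mathcal{T})$, and let $r\ge \ell$ be an integer. Let $\mathcal{F}_0,\ldots,\mathcal{F}_{g-1}$ be linearly independent finite families of elements of $\mathcal{T}$, with $k_i=\#\mathcal{F}_i$, such that $\{\operatorname{span}(\mathcal{F}_0),\ldots,\operatorname{span}(\mathcal{F}_{g-1})\}$ is a stem of $\mathcal{T}$. For each $i$: (a) let $\mathcal{Q}_i$ be a set containing exactly one representative of each orbit of the set $\Delta_{r-\ell+k_i}(\operatorname{span}(\mathcal{F}_i))$ under the action of $\operatorname{Stab}(\mathcal{F}_i)$ (the setwise stabilizer of the finite set $\mathcal{F}_i$); (b) let $\mathcal{L}_i\subset \operatorname{Stab}(\mathcal{F}_i)$ be a left transversal of $H_i=\operatorname{Stab}(\mathcal{T})\cap\operatorname{Stab}(\mathcal{F}_i)$ in $\operatorname{Stab}(\mathcal{F}_i)$, i.e. $\operatorname{Stab}(\mathcal{F}_i)$ is the disjoint union of the cosets $\sigma\circ H_i$, $\sigma\in\mathcal{L}_i$. Let $\mathcal{S}$ be the set of subspaces $\mathcal{T}+(\mathcal{W}\circ\sigma)$, for $i\in\{0,\ldots,g-1\}$, $\mathcal{W}\in\mathcal{Q}_i$, $\sigma\in\mathcal{L}_i$, such that $\mathcal{T}+(\mathcal{W}\circ\sigma)\in\mathcal{A}_{\dim(\mathcal{T}+(\mathcal{W}\circ\sigma))}$ (i.e.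 it is spanned by rank-one bilinear forms), and let $\mathcal{O}=\bigcup_{\mathcal{V}\in\mathcal{S}}\{\mathcal{V}\circ\tau : \tau\in\operatorname{Stab}(\mathcal{T})\}$. Then: (1) if $\mathcal{O}\neq\emptyset$ then $R\le r$ (every element of $\mathcal{O}$ contains $\mathcal{T}$, is spanned by rank-one forms and has dimension at most $r$); (2) $\Delta_r(\mathcal{T})\subset\mathcal{O}$; in particular if $\mathcal{O}=\emptyset$ then $\Delta_r(\mathcal{T})=\emptyset$.
   Context: $\mathcal{B}(m,n)$ denotes the $K$-vector space of bilinear forms $K^m\times K^n\to K$, identified with $m\times n$ matrices via $\Phi(\mathbf a,\mathbf b)=\mathbf a^T M\mathbf b$; the rank of a bilinear form is the rank of its matrix, and rank-one forms are those of the form $(\mathbf a,\mathbf b)\mapsto\alpha(\mathbf a)\beta(\mathbf b)$ with $\alpha,\beta$ nonzero linear forms. For $d\ge0$, $\mathcal{A}_d$ denotes the set of subspaces of $\mathcal{B}(m,n)$ spanned by a linearly independent family of $d$ rank-one bilinear forms. For a subspace $\mathcal{T}$, $\Delta_d(\mathcal{T})=\{\mathcal{V}\in\mathcal{A}_d:\mathcal{T}\subset\mathcal{V}\}$, and the rank $\operatorname{rk}(\mathcal{T})$ is the smallest $d$ with $\Delta_d(\mathcal{T})\neq\emptyset$. The group $G=GL(K^m)\times GL(K^n)$ acts on $\mathcal{B}(m,n)$ by $(\Phi\circ\sigma)(\mathbf a,\mathbf b)=\Phi(\mu(\mathbf a),\nu(\mathbf b))$ for $\sigma=(\mu,\nu)$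 (in matrix terms $M\cdot(X,Y)=X^TMY$); this extends elementwise to subsets and subspaces. For a subset $\mathcal{S}$, $\operatorname{Stab}(\mathcal{S})=\{\sigma\in G:\mathcal{S}\circ\sigma=\mathcal{S}\}$ (setwise stabilizer). A set $\{\mathcal{F}_0,\ldots,\mathcal{F}_{g-1}\}$ of subspaces of $\mathcal{T}$, with $\dim\mathcal{F}_i=k_i$, is a stem of $\mathcal{T}$ if for every basis $\mathcal{B}$ of $\mathcal{T}$ there exist $i$, $\sigma\in\operatorname{Stab}(\mathcal{T})$ and a subfamily $\mathcal{F}\subset\mathcal{B}$ of size $k_i$ with $\operatorname{span}(\mathcal{F})\circ\sigma=\mathcal{F}_i$. *)

theory Defs
  imports "HOL-Analysis.Analysis" "HOL-Library.Set_Algebras"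
begin

text \<open>
  A bilinear form on \<open>K\<^sup>m \<times> K\<^sup>n\<close> is represented by its \<open>m \<times> n\<close> matrix \<open>M\<close>; the form itself is
  \<open>bform M\<close>. The lemmas \<open>ex1_bform\<close>, \<open>bform_add\<close> and \<open>bform_mscale\<close> show that this is an
  isomorphism of vector spaces.
\<close>

definition bform :: "'k::field^'n^'m \<Rightarrow> 'k^'m \<Rightarrow> 'k^'n \<Rightarrow> 'k" where
  "bform M a b = (\<Sum>i\<in>UNIV. a $ i * (M *v b) $ i)"

text \<open>The library's \<open>*s\<close> multiplies each row of a matrix componentwise by a vector, not by a scalar.\<close>

definition mscale :: "'k::field \<Rightarrow> 'k^'n^'m \<Rightarrow> 'k^'n^'m" where
  "mscale c M = (\<chi> i. c *s (M $ i))"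

interpretation bil: vector_space "mscale :: 'k::field \<Rightarrow> 'k^'n^'m \<Rightarrow> 'k^'n^'m"
  by unfold_locales (simp_all add: mscale_def vec_eq_iff algebra_simps)

lemma bform_add: "bform (M + N) a b = bform M a b + bform N a b"
  by (simp add: bform_def matrix_vector_mult_add_rdistrib algebra_simps sum.distrib)

lemma bform_mscale: "bform (mscale c M) a b = c * bform M a b"
  by (simp add: bform_def mscale_def matrix_vector_mult_def sum_distrib_left mult.left_commute mult.assoc)

lemma bform_axis: "bform M (axis i 1) (axis j 1) = M $ i $ j"
  by (simp add: bform_def matrix_vector_mult_def axis_def if_distrib if_distribR cong: if_cong)

lemma linear_bform:
  fixes M :: "'k::field^'n^'m"
  shows "Vector_Spaces.linear (*s) (*) (\<lambda>a. bform M a b)"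
    and "Vector_Spaces.linear (*s) (*) (bform M a)"
  by unfold_locales
    (simp_all add: bform_def matrix_vector_mult_def sum.distrib sum_distrib_left algebra_simps)

lemma linear_form_expansion:
  fixes f :: "'k::field^'n \<Rightarrow> 'k"
  assumes "Vector_Spaces.linear (*s) (*) f"
  shows "f x = (\<Sum>i\<in>UNIV. x $ i * f (axis i 1))"
proof -
  interpret f: Vector_Spaces.linear "(*s)" "(*)" f by (fact assms)
  have "f x = f (\<Sum>i\<in>UNIV. x $ i *s axis i 1)" by (simp only: basis_expansion)
  then show ?thesis by (simp add: f.sum f.scale)
qed

lemma ex1_bform:
  fixes \<Phi> :: "'k::field^'m \<Rightarrow> 'k^'n \<Rightarrow> 'k"
  assumes l: "\<And>b. Vector_Spaces.linear (*s) (*) (\<lambda>a. \<Phi> a b)"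
    and r: "\<And>a. Vector_Spaces.linear (*s) (*) (\<Phi> a)"
  shows "\<exists>!M. \<Phi> = bform M"
proof (rule ex_ex1I)
  have "\<Phi> a b = bform (\<chi> i j. \<Phi> (axis i 1) (axis j 1)) a b" for a b
    unfolding linear_form_expansion[OF l, of a b]
    by (simp add: bform_def matrix_vector_mult_def linear_form_expansion[OF r, of _ b] mult.commute)
  then show "\<exists>M. \<Phi> = bform M" by blast
next
  fix M N assume "\<Phi> = bform M" "\<Phi> = bform N"
  then have "bform M (axis i 1) (axis j 1) = bform N (axis i 1) (axis j 1)" for i j by simp
  then show "M = N" by (simp add: bform_axis vec_eq_iff)
qed

definition rank_one :: "'k::field^'n^'m \<Rightarrow> bool" where
  "rank_one M \<longleftrightarrow> (\<exists>\<alpha> \<beta>. Vector_Spaces.linear (*s) (*) \<alpha> \<and> Vector_Spaces.linear (*s) (*) \<beta> \<and>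
     \<alpha> \<noteq> (\<lambda>_. 0) \<and> \<beta> \<noteq> (\<lambda>_. 0) \<and> (\<forall>a b. bform M a b = \<alpha> a * \<beta> b))"

definition \<A> :: "nat \<Rightarrow> ('k::field^'n^'m) set set" where
  "\<A> d = {V. \<exists>B. finite B \<and> card B = d \<and> bil.independent B \<and> (\<forall>M\<in>B. rank_one M) \<and> V = bil.span B}"

definition \<Delta> :: "nat \<Rightarrow> ('k::field^'n^'m) set \<Rightarrow> ('k^'n^'m) set set" where
  "\<Delta> d T = {V \<in> \<A> d. T \<subseteq> V}"

definition rk :: "('k::field^'n^'m) set \<Rightarrow> nat" where
  "rk T = (LEAST d. \<Delta> d T \<noteq> {})"

type_synonym ('k, 'm, 'n) gl2 = "('k^'m^'m) \<times> ('k^'n^'n)"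

definition GL2 :: "('k::field, 'm::finite, 'n::finite) gl2 set" where
  "GL2 = {\<sigma>. invertible (fst \<sigma>) \<and> invertible (snd \<sigma>)}"

definition gcomp :: "('k::field, 'm::finite, 'n::finite) gl2 \<Rightarrow> ('k, 'm, 'n) gl2 \<Rightarrow> ('k, 'm, 'n) gl2" where
  "gcomp \<sigma> \<tau> = (fst \<sigma> ** fst \<tau>, snd \<sigma> ** snd \<tau>)"

definition act :: "'k::field^'n^'m \<Rightarrow> ('k, 'm, 'n) gl2 \<Rightarrow> 'k^'n^'m" where
  "act M \<sigma> = transpose (fst \<sigma>) ** M ** snd \<sigma>"

definition act_set :: "('k::field^'n^'m) set \<Rightarrow> ('k, 'm, 'n) gl2 \<Rightarrow> ('k^'n^'m) set"  (infixl "\<odot>" 75)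
  where "S \<odot> \<sigma> = (\<lambda>M. act M \<sigma>) ` S"

lemma bform_act: "bform (act M \<sigma>) a b = bform M (fst \<sigma> *v a) (snd \<sigma> *v b)"
proof -
  have "(\<Sum>i\<in>UNIV. a $ i * (transpose X *v y) $ i) = (\<Sum>i\<in>UNIV. (X *v a) $ i * y $ i)"
    for X :: "'k::field^'m^'m" and a y :: "'k^'m"
    by (simp add: matrix_vector_mult_def transpose_def sum_distrib_left sum_distrib_right)
       (subst sum.swap, simp add: ac_simps)
  then show ?thesis
    by (simp add: bform_def act_def flip: matrix_vector_mul_assoc)
qed

lemma act_gcomp: "act M (gcomp \<sigma> \<tau>) = act (act M \<sigma>) \<tau>"
  by (simp add: act_def gcomp_def matrix_transpose_mul matrix_mul_assoc)

definition Stab :: "('k::field^'n^'m) set \<Rightarrow> ('k, 'm, 'n) gl2 set" where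
  "Stab S = {\<sigma> \<in> GL2. S \<odot> \<sigma> = S}"

definition orbit :: "('k::field, 'm::finite, 'n::finite) gl2 set \<Rightarrow> ('k^'n^'m) set \<Rightarrow> ('k^'n^'m) set set" where
  "orbit H V = {V \<odot> \<sigma> | \<sigma>. \<sigma> \<in> H}"

definition orbit_representatives ::
    "('k::field, 'm::finite, 'n::finite) gl2 set \<Rightarrow> ('k^'n^'m) set set \<Rightarrow> ('k^'n^'m) set set \<Rightarrow> bool" where
  "orbit_representatives H X Q \<longleftrightarrow> Q \<subseteq> X \<and> (\<forall>\<omega> \<in> orbit H ` X. \<exists>!W. W \<in> Q \<and> W \<in> \<omega>)"

definition left_transversal ::
    "('k::field, 'm::finite, 'n::finite) gl2 set \<Rightarrow> ('k, 'm, 'n) gl2 set \<Rightarrow> ('k, 'm, 'n) gl2 set \<Rightarrow> bool" where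
  "left_transversal S H L \<longleftrightarrow> L \<subseteq> S \<and> (\<Union>\<sigma>\<in>L. gcomp \<sigma> ` H) = S \<and>
     disjoint_family_on (\<lambda>\<sigma>. gcomp \<sigma> ` H) L"

definition is_basis :: "('k::field^'n^'m) set \<Rightarrow> ('k^'n^'m) set \<Rightarrow> bool" where
  "is_basis T B \<longleftrightarrow> bil.independent B \<and> bil.span B = T"

definition stem :: "('k::field^'n^'m) set \<Rightarrow> ('k^'n^'m) set set \<Rightarrow> bool" where
  "stem T \<F> \<longleftrightarrow> finite \<F> \<and> (\<forall>U\<in>\<F>. bil.subspace U \<and> U \<subseteq> T) \<and>
     (\<forall>B. is_basis T B \<longrightarrow>
        (\<exists>U\<in>\<F>. \<exists>\<sigma>\<in>Stab T. \<exists>F\<subseteq>B. card F = bil.dim U \<and> bil.span F \<odot> \<sigma> = U))"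

end

theory Submission
  imports Defs
begin

text \<open>
  Let \<open>V\<close> contain \<open>T\<close> and be spanned by \<open>r\<close> independent rank-one forms. Steinitz exchange picks
  \<open>r - \<l>\<close> of them, say \<open>C\<close>, spanning a complement of \<open>T\<close> in \<open>V\<close>; projecting the remaining \<open>\<l>\<close>
  ones to \<open>T\<close> along \<open>C\<close> gives a basis of \<open>T\<close>. Adding to \<open>C\<close> the rank-one forms that project into a
  subfamily \<open>F\<close> of this basis gives a rank-one-spanned \<open>W\<close> of dimension \<open>r - \<l> + #F\<close> that contains
  \<open>F\<close> and satisfies \<open>T + W = V\<close>. The stem moves a suitable \<open>span F\<close> to some \<open>span F\<^sub>i\<close> by an element
  of \<open>Stab T\<close>, and then \<open>W\<close> is replaced by its orbit representative up to an element of \<open>Stab F\<^sub>i\<close>,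
  whose component in \<open>H\<^sub>i\<close> is absorbed by \<open>Stab T\<close>.
\<close>

section \<open>Dimension counts and basis exchange in vector spaces\<close>

context vector_space
begin

lemma span_plus_span: "span A + span B = span (A \<union> B)"
  by (auto simp: span_Un set_plus_def)

text \<open>The union generates the sum, and inclusion-exclusion counts the shared \<open>F\<close>
  only once.\<close>

lemma dim_span_plus_span_le:
  assumes "finite A" "finite B" "F \<subseteq> A \<inter> B"
  shows "dim (span A + span B) + card F \<le> card A + card B"
proof -
  have "dim (span A + span B) \<le> card (A \<union> B)"
    using assms by (simp add: span_plus_span dim_le_card')
  moreover have "card F \<le> card (A \<inter> B)"
    using assms by (intro card_mono) auto
  ultimately show ?thesis
    using card_Un_Int[OF assms(1,2)] by linarith
qed

text \<open>A maximal independent subset of \<open>B\<close> already has \<open>dim (span B)\<close>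
  elements, so it exhausts \<open>B\<close>.\<close>

lemma independent_if_card_le_dim_span:
  assumes "finite B" "card B \<le> dim (span B)"
  shows "independent B"
proof -
  obtain B' where B': "B' \<subseteq> B" "independent B'" "B \<subseteq> span B'"
    using maximal_independent_subset by blast
  have "card B' = dim B"
    using B' basis_card_eq_dim by blast
  with assms B' have "B' = B"
    by (intro card_seteq) auto
  with B' show ?thesis by simp
qed

text \<open>\<open>t\<close> is a projection to \<open>T\<close> along \<open>span C\<close>. The
  projected vectors together with \<open>C\<close> still span \<open>span A\<close> and number at
  most \<open>card A\<close>, so no two of them coincide and no linear relation holds among
  them.\<close>

lemma projected_basis_exists:
  assumes T: "subspace T" and A: "finite A" "independent A" and TA: "T \<subseteq> span A"
  obtains C t where "C \<subseteq> A" "inj_on t (A - C)" "independent (t ` (A - C))"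
    "span (t ` (A - C)) = T" "\<And>a. a \<in> A - C \<Longrightarrow> a - t a \<in> span C"
proof -
  obtain BT where BT: "BT \<subseteq> T" "independent BT" "T \<subseteq> span BT" "card BT = dim T"
    using basis_exists by blast
  have spBT: "span BT = T"
    using BT(1,3) T span_minimal by blast
  \<comment> \<open>Steinitz exchange: the basis \<open>BT\<close> of \<open>T\<close> is completed
    to a basis of \<open>span A\<close> by elements of \<open>A\<close> only; these will form
    \<open>C\<close>.\<close>
  obtain B where B: "BT \<subseteq> B" "B \<subseteq> BT \<union> A" "independent B" "BT \<union> A \<subseteq> span B"
    using maximal_independent_subset_extend[of BT "BT \<union> A"] BT(2) by blast
  define C where "C = B - BT"
  have CA: "C \<subseteq> A" and BC: "B = BT \<union> C"
    using B(1,2) by (auto simp: C_def)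
  have finC: "finite C"
    using CA A(1) finite_subset by blast
  have BsubA: "B \<subseteq> span A"
    using B(2) BT(1) TA span_superset by blast
  have spB: "span B = span A"
    using BsubA B(4) by (simp add: span_eq)
  have finB: "finite B"
    using independent_span_bound[OF A(1) B(3) BsubA] by simp
  have cardB: "card B = card A"
    using B(3) A(2) spB dim_span_eq_card_independent by metis
  have finBT: "finite BT"
    using finB B(1) finite_subset by blast
  have cardA: "card BT + card C = card A"
    using cardB card_Diff_subset[OF finBT B(1)] card_mono[OF finB B(1)] by (simp add: C_def)
  \<comment> \<open>Since \<open>BT \<union> C\<close> spans \<open>span A\<close>, each
    \<open>a\<close> splits into a part in \<open>T\<close> and a part in \<open>span C\<close>;
    \<open>t\<close> selects the former.\<close>
  have "\<exists>s. s \<in> T \<and> a - s \<in> span C" if "a \<in> A" for a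
  proof -
    have "a \<in> span (BT \<union> C)"
      using that B(4) BC by blast
    then show ?thesis
      unfolding span_Un spBT by force
  qed
  then obtain t where t: "\<And>a. a \<in> A \<Longrightarrow> t a \<in> T" "\<And>a. a \<in> A \<Longrightarrow> a - t a \<in> span C"
    by metis
  define D where "D = A - C"
  have finD: "finite D"
    using A by (simp add: D_def)
  have cardD: "card D = card BT"
    using cardA card_Diff_subset[OF finC CA] by (simp add: D_def)
  have "span A \<subseteq> span (t ` D \<union> C)"
  proof (rule span_minimal[OF subsetI subspace_span])
    fix a assume a: "a \<in> A"
    show "a \<in> span (t ` D \<union> C)"
    proof (cases "a \<in> C")
      case True
      then show ?thesis by (simp add: span_base)
    next
      case False
      then have "t a \<in> span (t ` D \<union> C)"
        using a by (auto simp: D_def intro: span_base)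
      moreover have "a - t a \<in> span (t ` D \<union> C)"
        using t(2)[OF a] span_mono[of C "t ` D \<union> C"] by blast
      ultimately show ?thesis
        using span_add by fastforce
    qed
  qed
  moreover have "t ` D \<union> C \<subseteq> span A"
    using t(1) TA CA span_superset[of A] by (auto simp: D_def)
  ultimately have sp: "span (t ` D \<union> C) = span A"
    using span_minimal[OF _ subspace_span] by blast
  have dimA: "dim (span A) = card A"
    using A(2) by (rule dim_span_eq_card_independent)
  have le1: "card (t ` D \<union> C) \<le> card (t ` D) + card C"
    by (rule card_Un_le)
  have le2: "card (t ` D) \<le> card D"
    using finD by (rule card_image_le)
  \<comment> \<open>Squeeze: the right-hand side is at most \<open>card D + card C = card A\<close>,
    so \<open>le1\<close> and \<open>le2\<close> become equalities, which gives injectivity here and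
    independence next.\<close>
  have "card A \<le> card (t ` D \<union> C)"
    using dim_le_card'[of "t ` D \<union> C"] finD finC sp dimA by (metis dim_span finite_UnI finite_imageI)
  then have inj: "card (t ` D) = card D"
    using le1 le2 cardA cardD by linarith
  have "independent (t ` D \<union> C)"
  proof (rule independent_if_card_le_dim_span)
    show "card (t ` D \<union> C) \<le> dim (span (t ` D \<union> C))"
      using le1 le2 cardA cardD sp dimA by simp
  qed (use finD finC in simp)
  then have ind: "independent (t ` D)"
    using independent_mono by blast
  have tDT: "t ` D \<subseteq> T"
    using t(1) by (auto simp: D_def)
  \<comment> \<open>A vector of \<open>T\<close> outside this span would yield
    \<open>card BT + 1\<close> independent vectors inside \<open>span BT\<close>.\<close>
  have spT: "span (t ` D) = T"
  proof (rule ccontr)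
    assume "span (t ` D) \<noteq> T"
    then obtain x where x: "x \<in> T" "x \<notin> span (t ` D)"
      using span_minimal[OF tDT T] by blast
    then have "independent (insert x (t ` D))" "x \<notin> t ` D"
      using ind independent_insertI span_base by blast+
    moreover have "insert x (t ` D) \<subseteq> span BT"
      using x tDT spBT by auto
    ultimately have "card (insert x (t ` D)) \<le> card BT"
      using independent_span_bound[OF finBT] by blast
    then show False
      using \<open>x \<notin> t ` D\<close> finD inj cardD by simp
  qed
  show ?thesis
  proof (rule that[OF CA])
    show "inj_on t (A - C)"
      using inj finD by (simp add: D_def eq_card_imp_inj_on)
  qed (use ind spT t(2) in \<open>auto simp: D_def\<close>)
qed

end

section \<open>The group action on matrices and on subspaces\<close>

text \<open>Values on unit vectors are the matrix entries. Matrix identities can thus be checked on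
  forms, where \<open>bform_act\<close> turns the action into substitution.\<close>

lemma bform_inject: "(\<And>a b. bform M a b = bform N a b) \<Longrightarrow> M = N"
  by (simp add: vec_eq_iff flip: bform_axis)

lemma linear_act: "Vector_Spaces.linear mscale mscale (\<lambda>M. act M \<sigma>)"
proof unfold_locales
  show "act (M + N) \<sigma> = act M \<sigma> + act N \<sigma>" for M N
    by (rule bform_inject) (simp add: bform_act bform_add)
  show "act (mscale c M) \<sigma> = mscale c (act M \<sigma>)" for c M
    by (rule bform_inject) (simp add: bform_act bform_mscale)
qed

interpretation act: Vector_Spaces.linear mscale mscale "\<lambda>M. act M \<sigma>" for \<sigma>
  by (rule linear_act)

lemma act_set_gcomp: "S \<odot> gcomp \<sigma> \<tau> = S \<odot> \<sigma> \<odot> \<tau>"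
  by (simp add: act_set_def act_gcomp image_image)

text \<open>Follows from linearity of the action. An element of \<open>Stab T\<close> can thereby be
  moved through \<open>T + W\<close> so as to affect \<open>W\<close> alone.\<close>

lemma act_set_plus: "(S + S') \<odot> \<sigma> = S \<odot> \<sigma> + S' \<odot> \<sigma>"
proof -
  have "(S + S') \<odot> \<sigma> = (\<Union>M\<in>S. \<Union>N\<in>S'. {act (M + N) \<sigma>})"
    by (auto simp: act_set_def set_plus_def)
  also have "\<dots> = S \<odot> \<sigma> + S' \<odot> \<sigma>"
    by (auto simp: act_set_def set_plus_def act.add)
  finally show ?thesis .
qed

lemma act_set_mono: "S \<subseteq> S' \<Longrightarrow> S \<odot> \<sigma> \<subseteq> S' \<odot> \<sigma>"
  by (auto simp: act_set_def)

lemma span_act_set: "bil.span (S \<odot> \<sigma>) = bil.span S \<odot> \<sigma>"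
  by (simp add: act_set_def act.span_image)

lemma gcomp_in_GL2: "\<sigma> \<in> GL2 \<Longrightarrow> \<tau> \<in> GL2 \<Longrightarrow> gcomp \<sigma> \<tau> \<in> GL2"
  by (simp add: GL2_def gcomp_def invertible_mult)

lemma GL2_inverse:
  fixes \<sigma> :: "('a::field, 'b::finite, 'c::finite) gl2"
  assumes "\<sigma> \<in> GL2"
  obtains \<tau> where "\<tau> \<in> GL2" "\<And>M. act (act M \<sigma>) \<tau> = M"
proof -
  obtain X Y where X: "fst \<sigma> ** X = mat 1" "X ** fst \<sigma> = mat 1"
    and Y: "snd \<sigma> ** Y = mat 1" "Y ** snd \<sigma> = mat 1"
    using assms by (auto simp: GL2_def invertible_def)
  show ?thesis
  proof (rule that[of "(X, Y)"])
    show "(X, Y) \<in> GL2"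
      using X Y by (auto simp: GL2_def invertible_def)
    have "gcomp \<sigma> (X, Y) = (mat 1, mat 1)"
      by (simp add: gcomp_def X Y)
    moreover have "act M (mat 1, mat 1) = M" for M :: "'a^'c^'b"
      by (simp add: act_def transpose_mat)
    ultimately show "act (act M \<sigma>) (X, Y) = M" for M
      by (simp flip: act_gcomp)
  qed
qed

lemma Stab_gcomp: "\<sigma> \<in> Stab S \<Longrightarrow> \<tau> \<in> Stab S \<Longrightarrow> gcomp \<sigma> \<tau> \<in> Stab S"
  by (simp add: Stab_def gcomp_in_GL2 act_set_gcomp)

lemma Stab_inverse:
  assumes "\<sigma> \<in> Stab S"
  obtains \<tau> where "\<tau> \<in> Stab S" "\<And>X. X \<odot> \<sigma> \<odot> \<tau> = X"
proof -
  obtain \<tau> where \<tau>: "\<tau> \<in> GL2" "\<And>M. act (act M \<sigma>) \<tau> = M"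
    by (rule GL2_inverse) (use assms in \<open>auto simp: Stab_def\<close>)
  have *: "X \<odot> \<sigma> \<odot> \<tau> = X" for X
    using \<tau> by (simp add: act_set_def image_image)
  \<comment> \<open>The cancellation law applied to \<open>S\<close> itself, using
    \<open>S \<odot> \<sigma> = S\<close>.\<close>
  have "S \<odot> \<tau> = S"
    using *[of S] assms by (simp add: Stab_def)
  with \<tau>(1) * show ?thesis
    by (intro that) (auto simp: Stab_def)
qed

lemma inj_act:
  assumes "\<sigma> \<in> GL2"
  shows "inj (\<lambda>M. act M \<sigma>)"
proof -
  obtain \<tau> where "\<And>M. act (act M \<sigma>) \<tau> = M"
    by (rule GL2_inverse[OF assms]) (rule that)
  then show ?thesis
    by (rule inj_on_inverseI)
qed

section \<open>Invariance of rank-one forms, \<open>\<A>\<close> and \<open>\<Delta>\<close>\<close>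

text \<open>Substitution acts on each factor separately: \<open>\<alpha>\<close> is composed with
  \<open>fst \<sigma>\<close> and \<open>\<beta>\<close> with \<open>snd \<sigma>\<close>.\<close>

lemma rank_one_act:
  assumes "\<sigma> \<in> GL2" "rank_one M"
  shows "rank_one (act M \<sigma>)"
proof -
  obtain \<alpha> \<beta> where lin: "Vector_Spaces.linear (*s) (*) \<alpha>" "Vector_Spaces.linear (*s) (*) \<beta>"
    and nz: "\<alpha> \<noteq> (\<lambda>_. 0)" "\<beta> \<noteq> (\<lambda>_. 0)" and M: "\<And>a b. bform M a b = \<alpha> a * \<beta> b"
    using assms(2) by (auto simp: rank_one_def)
  obtain X Y where X: "fst \<sigma> ** X = mat 1" and Y: "snd \<sigma> ** Y = mat 1"
    using assms(1) by (auto simp: GL2_def invertible_def)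
  have "Vector_Spaces.linear (*s) (*) (\<lambda>a. \<alpha> (fst \<sigma> *v a))"
    using Vector_Spaces.linear_compose[OF matrix_vector_mul_linear_gen lin(1)] by (simp add: o_def)
  moreover have "Vector_Spaces.linear (*s) (*) (\<lambda>b. \<beta> (snd \<sigma> *v b))"
    using Vector_Spaces.linear_compose[OF matrix_vector_mul_linear_gen lin(2)] by (simp add: o_def)
  \<comment> \<open>Evaluating at \<open>X *v a\<close>, with \<open>X\<close> a right inverse of
    \<open>fst \<sigma>\<close>, recovers \<open>\<alpha> a\<close>.\<close>
  moreover have "(\<lambda>a. \<alpha> (fst \<sigma> *v a)) \<noteq> (\<lambda>_. 0)"
  proof
    assume "(\<lambda>a. \<alpha> (fst \<sigma> *v a)) = (\<lambda>_. 0)"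
    then have "\<alpha> (fst \<sigma> *v (X *v a)) = 0" for a by meson
    with nz(1) X show False by (simp add: matrix_vector_mul_assoc fun_eq_iff)
  qed
  moreover have "(\<lambda>b. \<beta> (snd \<sigma> *v b)) \<noteq> (\<lambda>_. 0)"
  proof
    assume "(\<lambda>b. \<beta> (snd \<sigma> *v b)) = (\<lambda>_. 0)"
    then have "\<beta> (snd \<sigma> *v (Y *v b)) = 0" for b by meson
    with nz(2) Y show False by (simp add: matrix_vector_mul_assoc fun_eq_iff)
  qed
  ultimately show ?thesis
    unfolding rank_one_def bform_act M by blast
qed

lemma dim_of_mem_\<A>: "V \<in> \<A> d \<Longrightarrow> bil.dim V = d"
  by (auto simp: \<A>_def bil.dim_eq_card_independent)

lemma act_set_mem_\<A>:
  assumes "\<sigma> \<in> GL2" "V \<in> \<A> d"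
  shows "V \<odot> \<sigma> \<in> \<A> d"
proof -
  obtain B where B: "finite B" "card B = d" "bil.independent B" "\<forall>M\<in>B. rank_one M" "V = bil.span B"
    using assms(2) by (auto simp: \<A>_def)
  have "bil.independent (B \<odot> \<sigma>)"
    unfolding act_set_def using B(3)
    by (intro act.independent_injective_image inj_on_subset[OF inj_act[OF assms(1)]]) auto
  moreover have "card (B \<odot> \<sigma>) = d"
    unfolding act_set_def using B(2) inj_act[OF assms(1)]
    by (simp add: card_image inj_on_subset)
  moreover have "finite (B \<odot> \<sigma>)" "\<forall>M\<in>B \<odot> \<sigma>. rank_one M"
    using B(1,4) rank_one_act[OF assms(1)] by (auto simp: act_set_def)
  ultimately show ?thesis
    using B(5) by (auto simp: \<A>_def span_act_set)
qed

lemma act_set_mem_\<A>_dim: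
  assumes "\<sigma> \<in> GL2" "V \<in> \<A> (bil.dim V)"
  shows "V \<odot> \<sigma> \<in> \<A> (bil.dim (V \<odot> \<sigma>))" "bil.dim (V \<odot> \<sigma>) = bil.dim V"
  using act_set_mem_\<A>[OF assms] dim_of_mem_\<A>[OF act_set_mem_\<A>[OF assms]] by simp_all

lemma act_set_mem_\<Delta>: "\<sigma> \<in> GL2 \<Longrightarrow> V \<in> \<Delta> d U \<Longrightarrow> V \<odot> \<sigma> \<in> \<Delta> d (U \<odot> \<sigma>)"
  by (simp add: \<Delta>_def act_set_mem_\<A> act_set_mono)

section \<open>Decomposing \<open>V\<close> as \<open>T + W\<close>\<close>

text \<open>A single basis serves every subfamily \<open>F\<close>, as required by a stem, which
  selects the subfamily only after the basis is given.\<close>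

lemma \<Delta>_adapted_basis:
  assumes T: "bil.subspace T" and V: "V \<in> \<Delta> r T"
  obtains B where "is_basis T B"
    "\<And>F. F \<subseteq> B \<Longrightarrow> \<exists>W \<in> \<Delta> (r - bil.dim T + card F) (bil.span F). T + W = V"
proof -
  obtain A where A: "finite A" "card A = r" "bil.independent A" "\<forall>M\<in>A. rank_one M" "V = bil.span A"
    and TV: "T \<subseteq> bil.span A"
    using V by (auto simp: \<Delta>_def \<A>_def)
  obtain C t where C: "C \<subseteq> A" and inj: "inj_on t (A - C)" and ind: "bil.independent (t ` (A - C))"
    and sp: "bil.span (t ` (A - C)) = T" and t: "\<And>a. a \<in> A - C \<Longrightarrow> a - t a \<in> bil.span C"
    using bil.projected_basis_exists[OF T A(1,3) TV] by blast
  have finC: "finite C"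
    using C A(1) finite_subset by blast
  have dimT: "bil.dim T = card (A - C)"
    using ind sp inj bil.dim_span_eq_card_independent card_image by metis
  \<comment> \<open>The subtraction is not truncated: \<open>bil.dim T = card (A - C)\<close> is at
    most \<open>card A = r\<close>.\<close>
  then have cardC: "card C = r - bil.dim T"
    using A(1,2) C card_Diff_subset[OF finC C] card_mono[OF A(1) C] by simp
  show ?thesis
  proof (rule that)
    show "is_basis T (t ` (A - C))"
      using ind sp by (simp add: is_basis_def)
    fix F assume F: "F \<subseteq> t ` (A - C)"
    \<comment> \<open>The rank-one forms projecting into \<open>F\<close>; by injectivity of
      \<open>t\<close> there are exactly \<open>card F\<close> of them.\<close>
    define D where "D = {a \<in> A - C. t a \<in> F}"
    have FD: "F = t ` D"
      using F by (auto simp: D_def)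
    have D: "D \<subseteq> A - C"
      by (auto simp: D_def)
    have cardF: "card F = card D"
      unfolding FD using inj D by (rule card_image[OF inj_on_subset])
    have finD: "finite D"
      using D A(1) finite_subset by blast
    define W where "W = bil.span (C \<union> D)"
    have "card (C \<union> D) = r - bil.dim T + card F"
      using cardC cardF finC finD D by (subst card_Un_disjoint) auto
    moreover have "C \<union> D \<subseteq> A"
      using C D by auto
    ultimately have WA: "W \<in> \<A> (r - bil.dim T + card F)"
      unfolding \<A>_def W_def using A(3,4) finC finD bil.independent_mono[of A "C \<union> D"] by blast
    have "F \<subseteq> W"
    proof
      fix x assume "x \<in> F"
      then obtain a where a: "a \<in> D" "x = t a"
        using FD by auto
      then have "a \<in> W" "a - t a \<in> W"
        using t[of a] D bil.span_mono[of C "C \<union> D"] by (auto simp: W_def intro: bil.span_base)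
      \<comment> \<open>The projection \<open>t a\<close> differs from the generator
        \<open>a\<close> of \<open>W\<close> by an element of \<open>span C\<close>, which also lies
        in \<open>W\<close>.\<close>
      then have "a - (a - t a) \<in> W"
        unfolding W_def by (rule bil.span_diff)
      then show "x \<in> W" by (simp add: a)
    qed
    then have "bil.span F \<subseteq> W"
      unfolding W_def by (intro bil.span_minimal bil.subspace_span)
    with WA have "W \<in> \<Delta> (r - bil.dim T + card F) (bil.span F)"
      by (simp add: \<Delta>_def)
    moreover have "T + W = V"
    proof -
      have TW: "T + W = bil.span (t ` (A - C) \<union> (C \<union> D))"
        unfolding W_def sp[symmetric] by (rule bil.span_plus_span)
      \<comment> \<open>Elements of \<open>C\<close> lie in \<open>W\<close>; any other
        \<open>a\<close> is \<open>t a\<close> plus a correction in \<open>span C\<close>.\<close>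
      have "A \<subseteq> T + W"
      proof
        fix a assume a: "a \<in> A"
        show "a \<in> T + W"
        proof (cases "a \<in> C")
          case True
          then show ?thesis unfolding TW by (simp add: bil.span_base)
        next
          case False
          with a have "t a \<in> T" "a - t a \<in> W"
            using t[of a] bil.span_mono[of C "C \<union> D"] bil.span_superset[of "t ` (A - C)"] sp
            by (auto simp: W_def)
          then have "t a + (a - t a) \<in> T + W"
            by (rule set_plus_intro)
          then show ?thesis by simp
        qed
      qed
      then have "V \<subseteq> T + W"
        unfolding A(5) TW by (rule bil.span_minimal[OF _ bil.subspace_span])
      moreover have "T + W \<subseteq> V"
      proof -
        have "t ` (A - C) \<subseteq> bil.span A"
          using TV sp bil.span_superset[of "t ` (A - C)"] by simp
        then have "t ` (A - C) \<union> (C \<union> D) \<subseteq> bil.span A"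
          using C D bil.span_superset[of A] by blast
        then show ?thesis
          unfolding TW A(5) by (rule bil.span_minimal[OF _ bil.subspace_span])
      qed
      ultimately show ?thesis by blast
    qed
    ultimately show "\<exists>W \<in> \<Delta> (r - bil.dim T + card F) (bil.span F). T + W = V"
      by blast
  qed
qed

text \<open>\<open>F\<close> extends to a basis of \<open>T\<close> and to one of \<open>W\<close>,
  so the two bases share at least \<open>F\<close>.\<close>

lemma dim_plus_le:
  fixes T W :: "('k::{field,finite}^'n^'m) set"
  assumes "bil.subspace T" "bil.subspace W" "F \<subseteq> T" "F \<subseteq> W" "bil.independent F"
  shows "bil.dim (T + W) + card F \<le> bil.dim T + bil.dim W"
proof -
  obtain A where A: "F \<subseteq> A" "A \<subseteq> T" "bil.independent A" "T \<subseteq> bil.span A"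
    using bil.maximal_independent_subset_extend[OF assms(3,5)] by blast
  obtain B where B: "F \<subseteq> B" "B \<subseteq> W" "bil.independent B" "W \<subseteq> bil.span B"
    using bil.maximal_independent_subset_extend[OF assms(4,5)] by blast
  have "T = bil.span A" "W = bil.span B"
    using A B assms(1,2) bil.span_minimal by blast+
  moreover have "card A = bil.dim T" "card B = bil.dim W"
    using A B bil.basis_card_eq_dim by blast+
  ultimately show ?thesis
    using bil.dim_span_plus_span_le[of A B F] A(1) B(1) by simp
qed

section \<open>Soundness, completeness and the rank bound for the enumeration\<close>

theorem theorem3:
  fixes T :: "('k::{field,finite}^'n^'m) set"
    and \<l> R r g :: nat
    and F :: "nat \<Rightarrow> ('k^'n^'m) set"
    and k :: "nat \<Rightarrow> nat"
    and Q :: "nat \<Rightarrow> ('k^'n^'m) set set"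
    and L :: "nat \<Rightarrow> ('k, 'm, 'n) gl2 set"
    and \<S> \<O> :: "('k^'n^'m) set set"
  assumes "bil.subspace T" and "bil.dim T = \<l>" and "R = rk T" and "r \<ge> \<l>"
    and "\<And>i. i < g \<Longrightarrow> finite (F i) \<and> F i \<subseteq> T \<and> bil.independent (F i) \<and> k i = card (F i)"
    and "stem T ((\<lambda>i. bil.span (F i)) ` {..<g})"
    and "\<And>i. i < g \<Longrightarrow> orbit_representatives (Stab (F i)) (\<Delta> (r - \<l> + k i) (bil.span (F i))) (Q i)"
    and "\<And>i. i < g \<Longrightarrow> left_transversal (Stab (F i)) (Stab T \<inter> Stab (F i)) (L i)"
    and "\<S> = {T + (W \<odot> \<sigma>) | i W \<sigma>. i < g \<and> W \<in> Q i \<and> \<sigma> \<in> L i \<and>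
                T + (W \<odot> \<sigma>) \<in> \<A> (bil.dim (T + (W \<odot> \<sigma>)))}"
    and "\<O> = (\<Union>V\<in>\<S>. {V \<odot> \<tau> | \<tau>. \<tau> \<in> Stab T})"
  shows "(\<O> \<noteq> {} \<longrightarrow> R \<le> r) \<and>
         (\<forall>V\<in>\<O>. T \<subseteq> V \<and> V \<in> \<A> (bil.dim V) \<and> bil.dim V \<le> r) \<and>
         \<Delta> r T \<subseteq> \<O> \<and>
         (\<O> = {} \<longrightarrow> \<Delta> r T = {})"
proof -
  have sound: "T \<subseteq> V \<and> V \<in> \<A> (bil.dim V) \<and> bil.dim V \<le> r" if "V \<in> \<O>" for V
  proof -
    obtain i W \<sigma> \<tau> where i: "i < g" and W: "W \<in> Q i" and \<sigma>: "\<sigma> \<in> L i" and \<tau>: "\<tau> \<in> Stab T"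
      and A: "T + (W \<odot> \<sigma>) \<in> \<A> (bil.dim (T + (W \<odot> \<sigma>)))" and V: "V = (T + (W \<odot> \<sigma>)) \<odot> \<tau>"
      using \<open>V \<in> \<O>\<close> unfolding assms(9,10) by blast
    note Fi = assms(5)[OF i]
    have W\<Delta>: "W \<in> \<Delta> (r - \<l> + k i) (bil.span (F i))"
      using assms(7)[OF i] W by (auto simp: orbit_representatives_def)
    have \<sigma>F: "\<sigma> \<in> GL2" "F i \<odot> \<sigma> = F i"
      using assms(8)[OF i] \<sigma> by (auto simp: left_transversal_def Stab_def)
    \<comment> \<open>Fixing \<open>F i\<close> as a set, \<open>\<sigma>\<close> fixes its span, so
      the moved space still contains \<open>F i\<close>.\<close>
    have "W \<odot> \<sigma> \<in> \<Delta> (r - \<l> + k i) (bil.span (F i))"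
      using act_set_mem_\<Delta>[OF \<sigma>F(1) W\<Delta>] by (simp add: \<sigma>F(2) flip: span_act_set)
    then have W\<sigma>: "W \<odot> \<sigma> \<in> \<A> (r - \<l> + k i)" "F i \<subseteq> W \<odot> \<sigma>"
      using bil.span_superset by (auto simp: \<Delta>_def)
    have "bil.subspace (W \<odot> \<sigma>)"
      using W\<sigma>(1) by (auto simp: \<A>_def)
    \<comment> \<open>The common family \<open>F i\<close> cancels \<open>k i\<close>, leaving
      \<open>\<l> + (r - \<l>)\<close>, which is \<open>r\<close> because
      \<open>r \<ge> \<l>\<close>.\<close>
    then have "bil.dim (T + W \<odot> \<sigma>) + k i \<le> \<l> + (r - \<l> + k i)"
      using dim_plus_le[of T "W \<odot> \<sigma>" "F i"] assms(1,2) Fi W\<sigma>(2) dim_of_mem_\<A>[OF W\<sigma>(1)]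
      by simp
    moreover have \<tau>T: "\<tau> \<in> GL2" "T \<odot> \<tau> = T"
      using \<tau> by (auto simp: Stab_def)
    ultimately have "V \<in> \<A> (bil.dim V)" "bil.dim V \<le> r"
      using act_set_mem_\<A>_dim[OF _ A] V assms(4) by auto
    moreover have "T \<subseteq> V"
    proof -
      have "0 \<in> W \<odot> \<sigma>"
        using \<open>bil.subspace (W \<odot> \<sigma>)\<close> by (rule bil.subspace_0)
      then have "T \<subseteq> T + W \<odot> \<sigma>"
        by (force simp: set_plus_def)
      then show ?thesis
        using act_set_mono \<tau>T(2) V by metis
    qed
    ultimately show ?thesis by blast
  qed
  have complete: "V \<in> \<O>" if V: "V \<in> \<Delta> r T" for V
  proof -
    obtain B where B: "is_basis T B"
      and BW: "\<And>G. G \<subseteq> B \<Longrightarrow> \<exists>W \<in> \<Delta> (r - bil.dim T + card G) (bil.span G). T + W = V"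
      using \<Delta>_adapted_basis[OF assms(1) V] by blast
    \<comment> \<open>The stem condition is applied to the adapted basis; \<open>G\<close> is the
      subfamily that it selects.\<close>
    obtain i \<sigma> G where i: "i < g" and \<sigma>: "\<sigma> \<in> Stab T" and G: "G \<subseteq> B"
      and cardG: "card G = bil.dim (bil.span (F i))" and spG: "bil.span G \<odot> \<sigma> = bil.span (F i)"
      using assms(6) B unfolding stem_def by blast
    note Fi = assms(5)[OF i]
    have cardG': "card G = k i"
      using cardG Fi by (simp add: bil.dim_eq_card_independent)
    obtain W' where W': "W' \<in> \<Delta> (r - \<l> + k i) (bil.span G)" and TW': "T + W' = V"
      using BW[OF G] cardG' assms(2) by auto
    have \<sigma>T: "\<sigma> \<in> GL2" "T \<odot> \<sigma> = T"
      using \<sigma> by (auto simp: Stab_def)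
    have W'\<sigma>: "W' \<odot> \<sigma> \<in> \<Delta> (r - \<l> + k i) (bil.span (F i))"
      using act_set_mem_\<Delta>[OF \<sigma>T(1) W'] spG by simp
    obtain W where W: "W \<in> Q i" "W \<in> orbit (Stab (F i)) (W' \<odot> \<sigma>)"
      using assms(7)[OF i] W'\<sigma> by (auto simp: orbit_representatives_def)
    then obtain \<rho> where \<rho>: "\<rho> \<in> Stab (F i)" "W = W' \<odot> \<sigma> \<odot> \<rho>"
      by (auto simp: orbit_def)
    \<comment> \<open>\<open>\<rho>'\<close> undoes \<open>\<rho>\<close>, expressing
      \<open>W' \<odot> \<sigma>\<close> through the representative \<open>W\<close>.\<close>
    obtain \<rho>' where \<rho>': "\<rho>' \<in> Stab (F i)" "\<And>X. X \<odot> \<rho> \<odot> \<rho>' = X"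
      by (rule Stab_inverse[OF \<rho>(1)]) (rule that)
    \<comment> \<open>In \<open>gcomp \<kappa> h\<close> the factor \<open>\<kappa>\<close> acts
      first, so \<open>h\<close>, which fixes \<open>T\<close>, ends up outermost and can be pulled
      out of the sum.\<close>
    obtain \<kappa> h where \<kappa>: "\<kappa> \<in> L i" and h: "h \<in> Stab T" and \<rho>'_eq: "\<rho>' = gcomp \<kappa> h"
    proof -
      have "\<rho>' \<in> (\<Union>\<sigma>\<in>L i. gcomp \<sigma> ` (Stab T \<inter> Stab (F i)))"
        using assms(8)[OF i] \<rho>'(1) by (simp add: left_transversal_def)
      then show ?thesis
        using that by blast
    qed
    have hT: "T \<odot> h = T"
      using h by (simp add: Stab_def)
    define U where "U = T + W \<odot> \<kappa>"
    have "V \<odot> \<sigma> = T + W' \<odot> \<sigma>"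
      by (simp add: act_set_plus \<sigma>T(2) flip: TW')
    also have "W' \<odot> \<sigma> = W \<odot> \<rho>'"
      by (simp add: \<rho>(2) \<rho>'(2))
    also have "\<dots> = W \<odot> \<kappa> \<odot> h"
      by (simp add: \<rho>'_eq act_set_gcomp)
    also have "T + W \<odot> \<kappa> \<odot> h = U \<odot> h"
      by (simp add: U_def act_set_plus hT)
    finally have V\<sigma>: "V \<odot> \<sigma> = U \<odot> h" .
    obtain \<sigma>' where \<sigma>': "\<sigma>' \<in> Stab T" "\<And>X. X \<odot> \<sigma> \<odot> \<sigma>' = X"
      by (rule Stab_inverse[OF \<sigma>]) (rule that)
    obtain h' where h': "h' \<in> Stab T" "\<And>X. X \<odot> h \<odot> h' = X"
      by (rule Stab_inverse[OF h]) (rule that)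
    \<comment> \<open>As an image of \<open>V\<close> under the group, \<open>U\<close> is also
      spanned by rank-one forms, so it passes the filter in \<open>\<S>\<close>.\<close>
    have U: "U = V \<odot> gcomp \<sigma> h'"
      by (simp add: act_set_gcomp V\<sigma> h'(2))
    \<comment> \<open>Conversely \<open>V\<close> comes from \<open>U\<close> by an element of
      \<open>Stab T\<close>, as membership in \<open>\<O>\<close> demands.\<close>
    have VU: "V = U \<odot> gcomp h \<sigma>'"
      by (simp add: act_set_gcomp \<sigma>'(2) flip: V\<sigma>)
    have "V \<in> \<A> r"
      using V by (simp add: \<Delta>_def)
    moreover have "gcomp \<sigma> h' \<in> GL2"
      using Stab_gcomp[OF \<sigma> h'(1)] by (simp add: Stab_def)
    ultimately have "U \<in> \<A> r"
      unfolding U by (rule act_set_mem_\<A>[rotated])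
    then have "U \<in> \<A> (bil.dim U)"
      using dim_of_mem_\<A> by metis
    then have "U \<in> \<S>"
      unfolding assms(9) using i W(1) \<kappa> U_def by blast
    moreover have "gcomp h \<sigma>' \<in> Stab T"
      using h \<sigma>'(1) by (rule Stab_gcomp)
    ultimately show ?thesis
      unfolding assms(10) using VU by blast
  qed
  have "R \<le> r" if "V \<in> \<O>" for V
  proof -
    \<comment> \<open>\<open>V\<close> itself is the witness, at index
      \<open>bil.dim V\<close>.\<close>
    have "\<Delta> (bil.dim V) T \<noteq> {}"
      using sound[OF that] by (auto simp: \<Delta>_def)
    then have "R \<le> bil.dim V"
      unfolding assms(3) rk_def by (rule Least_le)
    also have "\<dots> \<le> r"
      using sound[OF that] by blast
    finally show ?thesis .
  qed
  with sound complete show ?thesis by blast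
qed

end
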